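(* Let $m\in\mathbb{Z}$ be a cube-free integer with $m^2\not\equiv 1\pmod 9$, written $m=hk^2$ with $h,k\in\mathbb{Z}$ square-free and $(h,k)=1$, let $K=\mathbb{Q}(\sqrt[3]{m})$, and let $p\neq 2,3$ be a prime number. Let $g$ be the number of primitive solutions of the Thue–Mahler equation $$F(U,V)=kU^3-hV^3=\pm p^N$$ (which is finite). Then for all sufficiently large integers $n$ one has $$\left|\mathcal{M}_{p^n,K}^{\mathrm{mono}}\right|\le 2g.$$
   Context: A solution of $kU^3-hV^3=\pm p^N$ is a triple $(U,V,N)\in\mathbb{Z}^3$ satisfying the equation for one of the two signs; it is primitive if $\gcd(U,V)=1$. (By a theorem of Mahler the number of primitive solutions is finite.) An order of a number field $K$ of degree $d$ is a (unital) subring of $K$ that is a finitely generated $\mathbb{Z}$-module of rank $d$; its index is its index in $\mathcal{O}_K$; an order $\mathcal{O}$ is monogenic if $\mathcal{O}=\mathbb{Z}[\alpha]$ for some $\alpha\in\mathcal{O}$. Let $\mathcal{M}_N^d$ be the set of $d\times d$ lower triangular integer matrices $(a_{ij})$ with determinant $N$, $a_{ij}\ge 0$ for all $i,j$, and $a_{ij}<a_{jj}$ for $i>j$ (Hermite normal form). Fix an ordered integral basis $\{1,\alpha_1,\ldots,\alpha_{d-1}\}$ of $K$; for $M\in\mathcal{M}_N^d$ let $\mathcal{O}_M=\bigoplus_{i=1}^d\mathbb{Z}v_i$ with $(v_1,\ldots,v_d)^T=M(1,\alpha_1,\ldots,\alpha_{d-1})^T$. Put $\mathcal{M}_{N,K}=\{M\in\mathcal{M}_N^d:\mathcal{O}_M\text{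 is an order}\}$ (in bijection, via $M\mapsto\mathcal{O}_M$, with the orders of $K$ of index $N$) and $\mathcal{M}_{N,K}^{\mathrm{mono}}=\{M\in\mathcal{M}_{N,K}:\mathcal{O}_M\text{ is monogenic}\}$. Thus $|\mathcal{M}_{p^n,K}^{\mathrm{mono}}|$ is the number of monogenic orders of $K$ of index $p^n$. For $K=\mathbb{Q}(\theta)$, $\theta=\sqrt[3]{m}$, of the claim, $d=3$ and the integral basis used is $\{1,\theta,\theta^2/k\}$. "Sufficiently large" may depend on $K$ and $p$. *)

theory Defs
  imports
    Complex_Main
    "HOL-Number_Theory.Cong"
    "HOL-Computational_Algebra.Squarefree"
    "HOL-Library.Extended_Nat"
    "Jordan_Normal_Form.Determinant"
begin

section \<open>Cardinalities and cube-free integers\<close>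

text \<open>Unlike \<^const>\<open>card\<close>, this is not \<open>0\<close> on infinite sets.\<close>

definition ecard :: "'a set \<Rightarrow> enat" where
  "ecard A = (if finite A then enat (card A) else \<infinity>)"

definition cubefree :: "int \<Rightarrow> bool" where
  "cubefree m \<longleftrightarrow> (\<forall>x. x ^ 3 dvd m \<longrightarrow> is_unit x)"

section \<open>Number fields and orders\<close>

text \<open>Number fields and their orders are subsets of an ambient field of characteristic zero.\<close>

definition is_subring :: "'a::ring_1 set \<Rightarrow> bool" where
  "is_subring R \<longleftrightarrow> 1 \<in> R \<and> (\<forall>x\<in>R. \<forall>y\<in>R. x - y \<in> R \<and> x * y \<in> R)"

definition is_subfield :: "'a::field set \<Rightarrow> bool" where
  "is_subfield K \<longleftrightarrow> is_subring K \<and> (\<forall>x\<in>K. inverse x \<in> K)"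

text \<open>In characteristic zero every subfield contains the rationals, so this is \<open>\<rat>(x)\<close>.\<close>

definition rat_adjoin :: "'a::field_char_0 \<Rightarrow> 'a set" where
  "rat_adjoin x = is_subfield hull {x}"

text \<open>\<open>\<int>[x]\<close>\<close>

definition int_adjoin :: "'a::ring_1 \<Rightarrow> 'a set" where
  "int_adjoin x = is_subring hull {x}"

global_interpretation int_mod: Modules.module "\<lambda>(c::int) (x::'a::ring_1). of_int c * x"
  by unfold_locales (simp_all add: algebra_simps)

global_interpretation rat_vs: vector_space "\<lambda>(c::rat) (x::'a::field_char_0). of_rat c * x"
  by unfold_locales (simp_all add: algebra_simps of_rat_add of_rat_mult)

definition field_degree :: "'a::field_char_0 set \<Rightarrow> nat" where
  "field_degree K = rat_vs.dim K"

definition int_fin_gen :: "'a::ring_1 set \<Rightarrow> bool" where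
  "int_fin_gen A \<longleftrightarrow> (\<exists>S. finite S \<and> A = int_mod.span S)"

text \<open>The rank of a \<open>\<int>\<close>-module: the maximal number of \<open>\<int>\<close>-linearly independent elements.\<close>

definition has_int_rank :: "'a::ring_1 set \<Rightarrow> nat \<Rightarrow> bool" where
  "has_int_rank A r \<longleftrightarrow>
     (\<exists>B\<subseteq>A. finite B \<and> int_mod.independent B \<and> card B = r) \<and>
     (\<forall>B\<subseteq>A. finite B \<and> int_mod.independent B \<longrightarrow> card B \<le> r)"

definition is_order :: "'a::field_char_0 set \<Rightarrow> 'a set \<Rightarrow> bool" where
  "is_order K R \<longleftrightarrow>
     is_subring R \<and> R \<subseteq> K \<and> int_fin_gen R \<and> has_int_rank R (field_degree K)"

definition monogenic :: "'a::ring_1 set \<Rightarrow> bool" where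
  "monogenic R \<longleftrightarrow> (\<exists>x\<in>R. R = int_adjoin x)"

section \<open>Orders of given index via Hermite normal forms\<close>

definition hnf_matrices :: "nat \<Rightarrow> int \<Rightarrow> int mat set" where
  "hnf_matrices d N =
     {M \<in> carrier_mat d d.
        det M = N \<and>
        (\<forall>i<d. \<forall>j<d. i < j \<longrightarrow> M $$ (i, j) = 0) \<and>
        (\<forall>i<d. \<forall>j<d. 0 \<le> M $$ (i, j)) \<and>
        (\<forall>i<d. \<forall>j<d. j < i \<longrightarrow> M $$ (i, j) < M $$ (j, j))}"

text \<open>The \<open>\<int>\<close>-span of the entries of \<open>M b\<close>, for an ordered basis \<open>b\<close>; the sum of the
  lines spanned by these entries is direct as soon as \<open>det M \<noteq> 0\<close>.\<close>

definition lattice_of :: "'a::field_char_0 vec \<Rightarrow> int mat \<Rightarrow> 'a set" where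
  "lattice_of b M = int_mod.span (set\<^sub>v (map_mat of_int M *\<^sub>v b))"

text \<open>In the next two definitions \<open>b\<close> is meant to be an ordered integral basis of \<open>K\<close> with
  first entry \<open>1\<close>; then \<open>lattice_of b\<close> maps these matrices bijectively to the
  (monogenic) orders of \<open>K\<close> of index \<open>N\<close>.\<close>

definition order_matrices :: "'a::field_char_0 set \<Rightarrow> 'a vec \<Rightarrow> int \<Rightarrow> int mat set" where
  "order_matrices K b N = {M \<in> hnf_matrices (dim_vec b) N. is_order K (lattice_of b M)}"

definition mono_order_matrices :: "'a::field_char_0 set \<Rightarrow> 'a vec \<Rightarrow> int \<Rightarrow> int mat set" where
  "mono_order_matrices K b N = {M \<in> order_matrices K b N. monogenic (lattice_of b M)}"

section \<open>The Thue--Mahler equation\<close>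

text \<open>The exponent ranges over all integers, so the equation is stated in \<open>\<rat>\<close>.\<close>

definition primitive_solutions :: "int \<Rightarrow> int \<Rightarrow> nat \<Rightarrow> (int \<times> int \<times> int) set" where
  "primitive_solutions k h p =
     {(U, V, N). coprime U V \<and>
        (rat_of_int (k * U ^ 3 - h * V ^ 3) = of_nat p powi N \<or>
         rat_of_int (k * U ^ 3 - h * V ^ 3) = - (of_nat p powi N))}"

end

theory Submission
  imports Defs
begin

text \<open>
  Put \<open>\<omega> = \<theta>\<^sup>2 / k\<close>. Every monogenic order is \<open>\<int>[\<beta>]\<close> with \<open>\<beta> = x \<theta> + y \<omega>\<close>, since integer
  translations of a generator are harmless, and \<open>{1, \<beta>, \<beta>\<^sup>2}\<close> is a \<open>\<int>\<close>-basis of it. Its coordinate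
  matrix with respect to \<open>{1, \<theta>, \<omega>}\<close> has determinant \<open>k x\<^sup>3 - h y\<^sup>3\<close>, so this number is \<open>\<plusminus>p\<^sup>n\<close>.
  The gcd of \<open>x\<close> and \<open>y\<close> is then a power \<open>p\<^sup>j\<close>, and dividing by it gives a primitive solution
  \<open>(U, V, n - 3 j)\<close> from which, for given \<open>n\<close>, the order is recovered.
  Hermite normal forms being unique, there are at most \<open>g\<close> matrices, for every \<open>n\<close>.
\<close>

\<comment> \<open>\<open>of_int a * (of_int b * x) = of_int (a * b) * x\<close>, which loops together with \<open>mult.assoc\<close>\<close>
declare int_mod.scale_scale [simp del]

section \<open>Lattices and Hermite normal forms\<close>

text \<open>Independence of the entries as an indexed family: a repeated entry counts as a
  dependence, which the set of entries would not detect.\<close>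

definition int_indep_vec :: "'a::ring_1 vec \<Rightarrow> bool" where
  "int_indep_vec b \<longleftrightarrow>
     (\<forall>c::nat \<Rightarrow> int. (\<Sum>j<dim_vec b. of_int (c j) * b $ j) = 0 \<longrightarrow> (\<forall>j<dim_vec b. c j = 0))"

text \<open>Coefficients are attached to positions and not to values, so repeated generators do no
  harm. The right-hand side is a submodule that contains every generator, by unit coefficient
  vectors.\<close>

lemma int_span_image_lessThan:
  fixes f :: "nat \<Rightarrow> 'a::ring_1"
  shows "int_mod.span (f ` {..<d}) = range (\<lambda>c::nat \<Rightarrow> int. \<Sum>i<d. of_int (c i) * f i)"
    (is "_ = ?R")
proof
  have gen: "f i \<in> ?R" if "i < d" for i
  proof
    have "(\<Sum>l<d. of_int (if l = i then 1 else 0) * f l) = (\<Sum>l<d. if l = i then f l else 0)"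
      by (rule sum.cong) auto
    then show "f i = (\<Sum>l<d. of_int (if l = i then 1 else 0) * f l)"
      using that by simp
  qed simp
  have sub: "int_mod.subspace ?R"
    unfolding int_mod.subspace_def
  proof (intro conjI ballI allI)
    show "0 \<in> ?R"
      by (rule range_eqI[of _ _ "\<lambda>_. 0"]) simp
  next
    fix x y assume "x \<in> ?R" "y \<in> ?R"
    then obtain c e :: "nat \<Rightarrow> int" where
      "x = (\<Sum>i<d. of_int (c i) * f i)" "y = (\<Sum>i<d. of_int (e i) * f i)" by auto
    then show "x + y \<in> ?R"
      by (intro range_eqI[of _ _ "\<lambda>i. c i + e i"]) (simp add: distrib_right sum.distrib)
  next
    fix r x assume "x \<in> ?R"
    then obtain c :: "nat \<Rightarrow> int" where "x = (\<Sum>i<d. of_int (c i) * f i)" by auto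
    then show "of_int r * x \<in> ?R"
      by (intro range_eqI[of _ _ "\<lambda>i. r * c i"]) (simp add: sum_distrib_left mult.assoc)
  qed
  show "int_mod.span (f ` {..<d}) \<subseteq> ?R"
    by (rule int_mod.span_minimal[OF image_subsetI sub]) (simp only: lessThan_iff gen)
  show "?R \<subseteq> int_mod.span (f ` {..<d})"
    by (intro image_subsetI int_mod.span_sum int_mod.span_scale int_mod.span_base imageI)
qed

text \<open>The rows of \<open>M\<close> are the coordinate vectors of the generators, so the
  combination with coefficients \<open>c\<close> has the coordinate vector \<open>c M\<close>. This
  is an interchange of two finite sums.\<close>

lemma lattice_of_eq_range:
  assumes "M \<in> carrier_mat r d" "b \<in> carrier_vec d"
  shows "lattice_of b M =
    range (\<lambda>c::nat \<Rightarrow> int. \<Sum>j<d. of_int (\<Sum>i<r. c i * M $$ (i, j)) * b $ j)"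
proof -
  have "lattice_of b M = int_mod.span ((\<lambda>i. (map_mat of_int M *\<^sub>v b) $ i) ` {..<r})"
    using assms by (auto simp: lattice_of_def vec_set_def)
  also have "\<dots> = range (\<lambda>c::nat \<Rightarrow> int. \<Sum>i<r. of_int (c i) * (map_mat of_int M *\<^sub>v b) $ i)"
    by (rule int_span_image_lessThan)
  also have "(\<lambda>c::nat \<Rightarrow> int. \<Sum>i<r. of_int (c i) * (map_mat of_int M *\<^sub>v b) $ i)
      = (\<lambda>c. \<Sum>j<d. of_int (\<Sum>i<r. c i * M $$ (i, j)) * b $ j)"
  proof
    fix c :: "nat \<Rightarrow> int"
    have "(\<Sum>i<r. of_int (c i) * (map_mat of_int M *\<^sub>v b) $ i)
        = (\<Sum>i<r. \<Sum>j<d. of_int (c i * M $$ (i, j)) * b $ j)"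
      using assms
      by (intro sum.cong) (auto simp: scalar_prod_def sum_distrib_left mult.assoc lessThan_atLeast0)
    also have "\<dots> = (\<Sum>j<d. of_int (\<Sum>i<r. c i * M $$ (i, j)) * b $ j)"
      by (subst sum.swap) (simp add: sum_distrib_right)
    finally show "(\<Sum>i<r. of_int (c i) * (map_mat of_int M *\<^sub>v b) $ i)
        = (\<Sum>j<d. of_int (\<Sum>i<r. c i * M $$ (i, j)) * b $ j)" .
  qed
  finally show ?thesis .
qed

text \<open>Coordinates with respect to an independent \<open>b\<close> are unique. Hence each row
  of \<open>A\<close> is an integral combination of the rows of \<open>B\<close>, and the
  coefficients are the rows of \<open>P\<close>.\<close>

lemma lattice_of_subset_imp_mult:
  assumes A: "A \<in> carrier_mat r d" and B: "B \<in> carrier_mat s d"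
    and b: "b \<in> carrier_vec d" "int_indep_vec b"
    and sub: "lattice_of b A \<subseteq> lattice_of b B"
  obtains P where "P \<in> carrier_mat r s" "A = P * B"
proof -
  have "\<exists>c::nat \<Rightarrow> int. \<forall>j<d. A $$ (i, j) = (\<Sum>l<s. c l * B $$ (l, j))" if "i < r" for i
  proof -
    \<comment> \<open>The \<open>i\<close>-th unit vector as coefficient vector picks out row
      \<open>i\<close> of \<open>A\<close>.\<close>
    have "(\<Sum>j<d. of_int (\<Sum>l<r. (if l = i then 1 else 0) * A $$ (l, j)) * b $ j) \<in> lattice_of b A"
      unfolding lattice_of_eq_range[OF A b(1)] by (rule rangeI)
    moreover have "(\<Sum>l<r. (if l = i then 1 else 0) * A $$ (l, j)) = A $$ (i, j)" for j
    proof -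
      have "(\<Sum>l<r. (if l = i then 1 else 0) * A $$ (l, j)) = (\<Sum>l<r. if l = i then A $$ (l, j) else 0)"
        by (rule sum.cong) auto
      then show ?thesis using that by simp
    qed
    ultimately have "(\<Sum>j<d. of_int (A $$ (i, j)) * b $ j) \<in> lattice_of b B"
      using sub by auto
    then obtain c where
      "(\<Sum>j<d. of_int (A $$ (i, j)) * b $ j)
        = (\<Sum>j<d. of_int (\<Sum>l<s. c l * B $$ (l, j)) * b $ j)"
      unfolding lattice_of_eq_range[OF B b(1)] by auto
    then have "(\<Sum>j<d. of_int (A $$ (i, j) - (\<Sum>l<s. c l * B $$ (l, j))) * b $ j) = 0"
      by (simp add: left_diff_distrib sum_subtractf)
    with b have "\<forall>j<d. A $$ (i, j) - (\<Sum>l<s. c l * B $$ (l, j)) = 0"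
      unfolding int_indep_vec_def by (auto dest!: spec[of _ "\<lambda>j. A $$ (i, j) - (\<Sum>l<s. c l * B $$ (l, j))"])
    then show ?thesis by auto
  qed
  then obtain C :: "nat \<Rightarrow> nat \<Rightarrow> int" where
    C: "\<And>i j. i < r \<Longrightarrow> j < d \<Longrightarrow> A $$ (i, j) = (\<Sum>l<s. C i l * B $$ (l, j))"
    by metis
  have "A = mat r s (\<lambda>(i, l). C i l) * B"
    using A B by (intro eq_matI) (auto simp: C scalar_prod_def lessThan_atLeast0)
  then show ?thesis by (rule that[rotated]) simp
qed

text \<open>The two inclusions give \<open>A = P * B\<close> and \<open>B = Q * A\<close> over the
  integers, so each determinant divides the other. This is how the index of an order is read off
  from any of its bases.\<close>

lemma lattice_of_eq_imp_abs_det_eq: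
  assumes A: "A \<in> carrier_mat d d" and B: "B \<in> carrier_mat d d"
    and b: "b \<in> carrier_vec d" "int_indep_vec b"
    and eq: "lattice_of b A = lattice_of b B"
  shows "\<bar>det A\<bar> = \<bar>det B\<bar>"
proof -
  obtain P where P: "P \<in> carrier_mat d d" "A = P * B"
    by (rule lattice_of_subset_imp_mult[OF A B b equalityD1[OF eq]])
  obtain Q where Q: "Q \<in> carrier_mat d d" "B = Q * A"
    by (rule lattice_of_subset_imp_mult[OF B A b equalityD2[OF eq]])
  have "det B dvd det A" using P(2) det_mult[OF P(1) B] by simp
  moreover have "det A dvd det B" using Q(2) det_mult[OF Q(1) A] by simp
  ultimately show ?thesis by (rule zdvd_antisym_abs[rotated])
qed

section \<open>Uniqueness of the Hermite normal form\<close>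

lemma hnf_diag_pos:
  assumes M: "M \<in> hnf_matrices d N" and "N \<noteq> 0" "i < d"
  shows "0 < M $$ (i, i)"
proof -
  have c: "M \<in> carrier_mat d d" using M by (auto simp: hnf_matrices_def)
  have "det M = prod_list (diag_mat M)"
    by (rule det_lower_triangular[OF _ c]) (use M in \<open>auto simp: hnf_matrices_def\<close>)
  moreover have "det M \<noteq> 0" using M \<open>N \<noteq> 0\<close> by (simp add: hnf_matrices_def)
  ultimately have "0 \<notin> set (diag_mat M)" by (metis prod_list_zero_iff)
  then have "M $$ (i, i) \<noteq> 0"
    using c \<open>i < d\<close> by (force simp: diag_mat_def)
  moreover have "0 \<le> M $$ (i, i)"
    using M \<open>i < d\<close> by (auto simp: hnf_matrices_def)
  ultimately show ?thesis by simp
qed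

text \<open>Read the columns from the right: as \<open>w\<close> vanishes beyond \<open>j\<close>,
  so do the coefficients \<open>c l\<close> with \<open>l > j\<close>, and column \<open>j\<close>
  then reads \<open>w j = c j * M $$ (j, j)\<close>.\<close>

lemma lower_triangular_diag_dvd_row_combination:
  fixes M :: "'a::idom mat" and c w :: "nat \<Rightarrow> 'a"
  assumes low: "\<And>i l. i < l \<Longrightarrow> l < d \<Longrightarrow> M $$ (i, l) = 0"
    and diag: "\<And>i. i < d \<Longrightarrow> M $$ (i, i) \<noteq> 0"
    and w: "\<And>l. l < d \<Longrightarrow> w l = (\<Sum>i<d. c i * M $$ (i, l))"
    and zero: "\<And>l. j < l \<Longrightarrow> l < d \<Longrightarrow> w l = 0"
    and j: "j < d"
  shows "M $$ (j, j) dvd w j"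
proof -
  \<comment> \<open>In column \<open>l\<close> the rows above contribute nothing by triangularity,
    the rows below nothing because their coefficients vanish.\<close>
  have entry: "w l = c l * M $$ (l, l)" if "l < d" and "\<And>i. l < i \<Longrightarrow> i < d \<Longrightarrow> c i = 0" for l
  proof -
    have "c i * M $$ (i, l) = 0" if "i \<in> {..<d} - {l}" for i
      using that low[of i l] \<open>l < d\<close> \<open>\<And>i. l < i \<Longrightarrow> i < d \<Longrightarrow> c i = 0\<close>[of i]
      by (cases i l rule: linorder_cases) auto
    then have "(\<Sum>i\<in>{..<d} - {l}. c i * M $$ (i, l)) = 0"
      by (intro sum.neutral ballI)
    moreover have "w l = c l * M $$ (l, l) + (\<Sum>i\<in>{..<d} - {l}. c i * M $$ (i, l))"
      unfolding w[OF \<open>l < d\<close>] using \<open>l < d\<close> by (intro sum.remove) auto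
    ultimately show ?thesis by simp
  qed
  \<comment> \<open>The induction descends from the last column; \<open>d - l\<close> measures the
    distance to it.\<close>
  have "c l = 0" if "j < l" "l < d" for l
    using that
  proof (induction "d - l" arbitrary: l rule: less_induct)
    case less
    then have "c i = 0" if "l < i" "i < d" for i using that by simp
    then have "w l = c l * M $$ (l, l)" using less.prems by (intro entry) auto
    then show ?case using zero[of l] diag[of l] less.prems by simp
  qed
  then show ?thesis using entry[OF j] by simp
qed

lemma hnf_dvd_lattice_row:
  assumes "M \<in> hnf_matrices d N" "N \<noteq> 0"
    and "\<And>l. l < d \<Longrightarrow> w l = (\<Sum>i<d. c i * M $$ (i, l))"
    and "\<And>l. j < l \<Longrightarrow> l < d \<Longrightarrow> w l = 0" "j < d"
  shows "M $$ (j, j) dvd w j"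
proof (rule lower_triangular_diag_dvd_row_combination[of d M w c])
  show "M $$ (i, l) = 0" if "i < l" "l < d" for i l
    using assms(1) that by (simp add: hnf_matrices_def)
  show "M $$ (i, i) \<noteq> 0" if "i < d" for i
    using hnf_diag_pos[OF assms(1,2) that] by simp
qed (fact assms)+

text \<open>Row \<open>i\<close> of either matrix lies in the common lattice and vanishes to the
  right of \<open>i\<close>, so the diagonal entries divide each other. Below the diagonal, row
  \<open>i\<close> is compared from right to left: the first difference met would be a multiple of a
  diagonal entry that exceeds it in absolute value.\<close>

theorem hnf_unique:
  assumes A: "A \<in> hnf_matrices d N" and B: "B \<in> hnf_matrices d N'"
    and nz: "N \<noteq> 0" "N' \<noteq> 0"
    and b: "b \<in> carrier_vec d" "int_indep_vec b"
    and eq: "lattice_of b A = lattice_of b B"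
  shows "A = B"
proof -
  have car: "A \<in> carrier_mat d d" "B \<in> carrier_mat d d"
    using A B by (auto simp: hnf_matrices_def)
  have zeroA: "A $$ (i, j) = 0" and zeroB: "B $$ (i, j) = 0" if "i < j" "j < d" for i j
    using A B that by (auto simp: hnf_matrices_def)
  obtain P where P: "P \<in> carrier_mat d d" "A = P * B"
    by (rule lattice_of_subset_imp_mult[OF car b equalityD1[OF eq]])
  obtain Q where Q: "Q \<in> carrier_mat d d" "B = Q * A"
    by (rule lattice_of_subset_imp_mult[OF car(2,1) b equalityD2[OF eq]])
  have rowA: "A $$ (i, l) = (\<Sum>t<d. P $$ (i, t) * B $$ (t, l))" if "i < d" "l < d" for i l
    by (subst P(2)) (use P(1) car that in \<open>simp add: scalar_prod_def lessThan_atLeast0\<close>)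
  have rowB: "B $$ (i, l) = (\<Sum>t<d. Q $$ (i, t) * A $$ (t, l))" if "i < d" "l < d" for i l
    by (subst Q(2)) (use Q(1) car that in \<open>simp add: scalar_prod_def lessThan_atLeast0\<close>)
  have diag: "A $$ (i, i) = B $$ (i, i)" if i: "i < d" for i
  proof (rule zdvd_antisym_nonneg)
    show "A $$ (i, i) dvd B $$ (i, i)"
      by (rule hnf_dvd_lattice_row[OF A nz(1), of "\<lambda>l. B $$ (i, l)"]) (use i rowB zeroB in auto)
    show "B $$ (i, i) dvd A $$ (i, i)"
      by (rule hnf_dvd_lattice_row[OF B nz(2), of "\<lambda>l. A $$ (i, l)"]) (use i rowA zeroA in auto)
  qed (use A B i in \<open>auto simp: hnf_matrices_def\<close>)
  have below: "A $$ (i, j) = B $$ (i, j)" if i: "i < d" and j: "j < i" for i j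
    using j
  proof (induction "i - j" arbitrary: j rule: less_induct)
    case less
    define w where "w l = A $$ (i, l) - B $$ (i, l)" for l
    \<comment> \<open>The difference of the two rows is in the lattice of \<open>A\<close>: its
      coefficients are the \<open>i\<close>-th unit vector minus row \<open>i\<close> of
      \<open>Q\<close>.\<close>
    have w: "w l = (\<Sum>t<d. ((if t = i then 1 else 0) - Q $$ (i, t)) * A $$ (t, l))" if "l < d" for l
    proof -
      have "(\<Sum>t<d. (if t = i then 1 else 0) * A $$ (t, l)) = (\<Sum>t<d. if t = i then A $$ (t, l) else 0)"
        by (rule sum.cong) auto
      also have "\<dots> = A $$ (i, l)" using i by simp
      finally show ?thesis
        by (simp only: w_def rowB[OF i that] left_diff_distrib sum_subtractf)
    qed
    have "w l = 0" if "j < l" "l < d" for l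
      using that less diag[OF i] zeroA[of i l] zeroB[of i l]
      by (cases l i rule: linorder_cases) (auto simp: w_def)
    then have "A $$ (j, j) dvd w j"
      using less.prems i w by (intro hnf_dvd_lattice_row[OF A nz(1), of w]) auto
    \<comment> \<open>Both entries are reduced modulo the same diagonal entry.\<close>
    moreover have "\<bar>w j\<bar> < A $$ (j, j)"
    proof -
      have "0 \<le> A $$ (i, j)" "0 \<le> B $$ (i, j)" "A $$ (i, j) < A $$ (j, j)" "B $$ (i, j) < B $$ (j, j)"
        using A B i less.prems by (auto simp: hnf_matrices_def)
      then show ?thesis using diag[of j] i less.prems by (simp add: w_def)
    qed
    ultimately have "w j = 0"
      by (meson abs_ge_self dvd_imp_le_int leD order_trans)
    then show ?case by (simp add: w_def)
  qed
  show ?thesis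
  proof (rule eq_matI)
    fix i j assume "i < dim_row B" "j < dim_col B"
    then show "A $$ (i, j) = B $$ (i, j)"
      using car diag below zeroA[of i j] zeroB[of i j] by (cases i j rule: linorder_cases) auto
  qed (use car in auto)
qed

section \<open>Monogenic rings\<close>

lemma is_subring_int_adjoin: "is_subring (int_adjoin x)"
  unfolding int_adjoin_def by (rule hull_in) (auto simp: is_subring_def)

lemma self_in_int_adjoin: "x \<in> int_adjoin x"
  unfolding int_adjoin_def using hull_subset[of "{x}" is_subring] by simp

lemma int_adjoin_minimal: "x \<in> R \<Longrightarrow> is_subring R \<Longrightarrow> int_adjoin x \<subseteq> R"
  unfolding int_adjoin_def by (rule hull_minimal) simp_all

lemma is_subring_zero:
  assumes "is_subring R" shows "0 \<in> R"
  using assms by (metis cancel_comm_monoid_add_class.diff_cancel is_subring_def)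

lemma is_subring_uminus:
  assumes "is_subring R" "x \<in> R" shows "- x \<in> R"
  using assms is_subring_zero[OF assms(1)] by (metis diff_0 is_subring_def)

lemma is_subring_add:
  assumes "is_subring R" "x \<in> R" "y \<in> R" shows "x + y \<in> R"
  using assms is_subring_uminus[of R y] by (metis diff_minus_eq_add is_subring_def)

lemma is_subring_of_int:
  assumes "is_subring R" shows "of_int n \<in> R"
proof (induction n rule: int_induct[of _ 0])
  case base
  then show ?case using is_subring_zero[OF assms] by simp
next
  case (step1 i)
  then show ?case using assms by (simp add: is_subring_add is_subring_def)
next
  case (step2 i)
  then show ?case using assms by (simp add: is_subring_def)
qed

text \<open>Subrings contain the integers, which gives one inclusion for every translation;
  translating back gives the other.\<close>

lemma int_adjoin_translate:
  "int_adjoin (x + of_int n) = int_adjoin x"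
proof -
  have sub: "int_adjoin (y + of_int l) \<subseteq> int_adjoin y" for y :: 'a and l
    by (intro int_adjoin_minimal is_subring_add is_subring_int_adjoin
        self_in_int_adjoin is_subring_of_int)
  from sub[of x n] sub[of "x + of_int n" "- n"] show ?thesis by simp
qed

lemma int_span_three_eq:
  "int_mod.span {x, y, z} = {of_int a * x + of_int b * y + of_int c * z | a b c. True}"
  by (auto simp: int_mod.span_insert int_mod.span_singleton algebra_simps)

text \<open>The relation keeps the span stable under multiplication by \<beta>, and Horner's scheme
  then yields closure under all products. A relation without quadratic term is enough, as the
  generators in question have trace zero.\<close>

lemma int_adjoin_cubic:
  fixes \<beta> :: "'a::comm_ring_1"
  assumes cubic: "\<beta> ^ 3 = of_int r * \<beta> + of_int s"
  shows "int_adjoin \<beta> = int_mod.span {1, \<beta>, \<beta>\<^sup>2}"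
proof
  let ?S = "int_mod.span {1, \<beta>, \<beta>\<^sup>2}"
  have mult_\<beta>: "\<beta> * x \<in> ?S" if x: "x \<in> ?S" for x
  proof -
    obtain a b c where "x = of_int a * 1 + of_int b * \<beta> + of_int c * \<beta>\<^sup>2"
      using x unfolding int_span_three_eq by auto
    then have "\<beta> * x = of_int a * \<beta> + of_int b * \<beta>\<^sup>2 + of_int c * \<beta> ^ 3"
      by (simp add: algebra_simps power2_eq_square power3_eq_cube)
    also have "\<dots> = of_int (c * s) * 1 + of_int (a + c * r) * \<beta> + of_int b * \<beta>\<^sup>2"
      by (simp add: cubic algebra_simps)
    finally show ?thesis unfolding int_span_three_eq by blast
  qed
  have "is_subring ?S"
    unfolding is_subring_def
  proof (intro conjI ballI)
    fix x y assume x: "x \<in> ?S" and y: "y \<in> ?S"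
    show "x - y \<in> ?S" using x y by (rule int_mod.span_diff)
    obtain a b c where "x = of_int a * 1 + of_int b * \<beta> + of_int c * \<beta>\<^sup>2"
      using x unfolding int_span_three_eq by auto
    then have "x * y = of_int a * y + of_int b * (\<beta> * y) + of_int c * (\<beta> * (\<beta> * y))"
      by (simp add: algebra_simps power2_eq_square)
    then show "x * y \<in> ?S"
      using y by (auto intro!: int_mod.span_add int_mod.span_scale mult_\<beta>)
  qed (simp add: int_mod.span_base)
  then show "int_adjoin \<beta> \<subseteq> ?S"
    by (intro int_adjoin_minimal int_mod.span_base) auto
  have sr: "is_subring (int_adjoin \<beta>)" by (rule is_subring_int_adjoin)
  show "?S \<subseteq> int_adjoin \<beta>"
  proof (rule int_mod.span_minimal)
    show "{1, \<beta>, \<beta>\<^sup>2} \<subseteq> int_adjoin \<beta>"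
      using sr self_in_int_adjoin[of \<beta>] by (auto simp: is_subring_def power2_eq_square)
    show "int_mod.subspace (int_adjoin \<beta>)"
      using sr is_subring_of_int[OF sr]
      by (auto simp: int_mod.subspace_def is_subring_zero is_subring_add) (auto simp: is_subring_def)
  qed
qed

section \<open>Pure cubic fields\<close>

lemma cubefree_cube_square_eq_1:
  assumes "cubefree (t ^ 3)" shows "(t ^ 3)\<^sup>2 = 1"
proof -
  have "is_unit t" using assms by (auto simp: cubefree_def)
  then have "t = 1 \<or> t = -1" by auto
  then show ?thesis by auto
qed

text \<open>If \<open>C\<close> were nonzero, it would divide \<open>B\<close>, and \<open>m\<close>
  would be the cube of the quotient; but 1 and -1 are the only cube-free cubes.\<close>

lemma cubefree_no_rational_cube_root:
  fixes m B C :: int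
  assumes "cubefree m" "m\<^sup>2 \<noteq> 1" "B ^ 3 = C ^ 3 * m"
  shows "C = 0"
proof (rule ccontr)
  assume C: "C \<noteq> 0"
  have "C ^ 3 dvd B ^ 3" using assms(3) by simp
  then obtain t where "B = C * t" by (auto simp: pow_divides_pow_iff)
  then have "m = t ^ 3" using assms(3) C by (simp add: power_mult_distrib)
  then show False using assms(1,2) cubefree_cube_square_eq_1 by simp
qed

text \<open>Multiplying the relation by \<open>B - C * \<theta>\<close> cancels the \<theta>^2 terms
  and leaves a linear relation, whose coefficients vanish by irrationality. Eliminating
  \<open>A\<close> from them gives \<open>B ^ 3 = C ^ 3 * m\<close>.\<close>

lemma cube_root_int_indep:
  fixes \<theta> :: real and m A B C :: int
  assumes m: "cubefree m" "m\<^sup>2 \<noteq> 1" and cube: "\<theta> ^ 3 = of_int m"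
    and rel: "of_int A + of_int B * \<theta> + of_int C * \<theta>\<^sup>2 = 0"
  shows "A = 0 \<and> B = 0 \<and> C = 0"
proof -
  have irr: "s = 0 \<and> r = 0" if "of_int r + of_int s * \<theta> = 0" for r s :: int
  proof -
    have "of_int s * \<theta> = of_int (- r)" using that by simp
    then have "(of_int s * \<theta>) ^ 3 = of_int ((- r) ^ 3)" by (metis of_int_power)
    then have "of_int ((- r) ^ 3) = (of_int (s ^ 3 * m) :: real)"
      by (simp add: power_mult_distrib cube)
    then have "s = 0" by (intro cubefree_no_rational_cube_root[OF m, of "- r"]) (simp only: of_int_eq_iff)
    then show ?thesis using that by simp
  qed
  have "of_int (A * B - C\<^sup>2 * m) + of_int (B\<^sup>2 - A * C) * \<theta>
      = of_int B * (of_int A + of_int B * \<theta> + of_int C * \<theta>\<^sup>2)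
        - of_int C * \<theta> * (of_int A + of_int B * \<theta> + of_int C * \<theta>\<^sup>2)
        + (of_int C)\<^sup>2 * (\<theta> ^ 3 - of_int m)"
    by (simp add: algebra_simps power2_eq_square power3_eq_cube)
  also have "\<dots> = 0" by (simp add: rel cube)
  finally have "B\<^sup>2 = A * C" "A * B = C\<^sup>2 * m" using irr by fastforce+
  then have "B * B\<^sup>2 = C * (C\<^sup>2 * m)" by (metis mult.assoc mult.commute)
  then have "B ^ 3 = C ^ 3 * m" by (simp add: power3_eq_cube power2_eq_square mult.assoc)
  then have "C = 0" by (rule cubefree_no_rational_cube_root[OF m])
  then show ?thesis using irr[of A B] rel by simp
qed

lemma int_indep_vec_pure_cubic:
  fixes \<theta> :: real and m k :: int
  assumes "cubefree m" "m\<^sup>2 \<noteq> 1" "\<theta> ^ 3 = of_int m" "k \<noteq> 0"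
  shows "int_indep_vec (vec_of_list [1, \<theta>, \<theta>\<^sup>2 / of_int k])"
  unfolding int_indep_vec_def
proof (intro allI impI)
  fix c :: "nat \<Rightarrow> int" and j
  assume "(\<Sum>j<dim_vec (vec_of_list [1, \<theta>, \<theta>\<^sup>2 / of_int k]).
      of_int (c j) * vec_of_list [1, \<theta>, \<theta>\<^sup>2 / of_int k] $ j) = 0"
    and j: "j < dim_vec (vec_of_list [1, \<theta>, \<theta>\<^sup>2 / of_int k])"
  then have "of_int (c 0) + of_int (c 1) * \<theta> + of_int (c 2) * (\<theta>\<^sup>2 / of_int k) = 0"
    by (simp add: numeral_3_eq_3 numeral_2_eq_2)
  then have "of_int (k * c 0) + of_int (k * c 1) * \<theta> + of_int (c 2) * \<theta>\<^sup>2 = 0"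
    using \<open>k \<noteq> 0\<close> by (simp add: field_simps)
  from cube_root_int_indep[OF assms(1-3) this] have "c 0 = 0" "c 1 = 0" "c 2 = 0"
    using \<open>k \<noteq> 0\<close> by auto
  then show "c j = 0" using j by (auto simp: less_Suc_eq numeral_2_eq_2)
qed

section \<open>Power bases and the index form\<close>

text \<open>The rows are the coordinates of 1, \<beta> and \<beta>^2 with respect to 1, \<theta>,
  \<omega>, where \<beta> = x \<theta> + y \<omega>.\<close>

definition power_basis_mat :: "int \<Rightarrow> int \<Rightarrow> int \<Rightarrow> int \<Rightarrow> int mat" where
  "power_basis_mat h k x y =
     mat_of_rows_list 3 [[1, 0, 0], [0, x, y], [2 * x * y * h * k, y\<^sup>2 * h, x\<^sup>2 * k]]"

lemma power_basis_mat_carrier: "power_basis_mat h k x y \<in> carrier_mat 3 3"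
  by (simp add: power_basis_mat_def mat_of_rows_list_def numeral_3_eq_3)

lemma det_2x2:
  fixes A :: "'a::comm_ring_1 mat"
  assumes A: "A \<in> carrier_mat 2 2"
  shows "det A = A $$ (0, 0) * A $$ (1, 1) - A $$ (0, 1) * A $$ (1, 0)"
proof -
  have "det (mat_delete A 0 j) = A $$ (1, 1 - j)" if "j < 2" for j
  proof -
    have "mat_delete A 0 j \<in> carrier_mat 1 1"
      using mat_delete_carrier[OF A] by simp
    then show ?thesis
      using that A by (auto simp: det_single mat_delete_def less_2_cases_iff)
  qed
  then show ?thesis
    by (simp add: laplace_expansion_row[OF A, of 0] cofactor_def numeral_2_eq_2)
qed

text \<open>The first row is (1, 0, 0), so only the lower right block counts. The result is the
  index form of the basis.\<close>

lemma det_power_basis_mat: "det (power_basis_mat h k x y) = k * x ^ 3 - h * y ^ 3"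
proof -
  let ?P = "power_basis_mat h k x y" and ?D = "mat_delete (power_basis_mat h k x y) 0 0"
  have row: "?P $$ (0, 0) = 1" "?P $$ (0, 1) = 0" "?P $$ (0, 2) = 0"
    by (simp_all add: power_basis_mat_def mat_of_rows_list_def)
  have "det ?P = cofactor ?P 0 0"
    unfolding laplace_expansion_row[OF power_basis_mat_carrier, of 0, simplified] using row
    by (simp add: numeral_3_eq_3 numeral_2_eq_2)
  also have "\<dots> = det ?D" by (simp add: cofactor_def)
  also have "\<dots> = x * (x\<^sup>2 * k) - y * (y\<^sup>2 * h)"
    using mat_delete_carrier[OF power_basis_mat_carrier, of h k x y 0 0]
    by (simp add: det_2x2) (simp add: mat_delete_def power_basis_mat_def mat_of_rows_list_def)
  finally show ?thesis by (simp add: power2_eq_square power3_eq_cube algebra_simps)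
qed

lemma vec_of_list_3_carrier: "vec_of_list [x, y, z] \<in> carrier_vec 3"
  by (rule carrier_vecI) simp

lemma int_adjoin_eq_lattice_of:
  fixes \<theta> \<omega> :: "'a::field_char_0"
  assumes "\<theta>\<^sup>2 = of_int k * \<omega>" "\<theta> * \<omega> = of_int (h * k)" "\<omega>\<^sup>2 = of_int h * \<theta>"
  shows "int_adjoin (of_int x * \<theta> + of_int y * \<omega>)
    = lattice_of (vec_of_list [1, \<theta>, \<omega>]) (power_basis_mat h k x y)"
proof -
  define \<beta> where "\<beta> = of_int x * \<theta> + of_int y * \<omega>"
  have sq: "\<beta>\<^sup>2 = of_int (2 * x * y * h * k) + of_int (y\<^sup>2 * h) * \<theta> + of_int (x\<^sup>2 * k) * \<omega>"
  proof -
    have "\<beta>\<^sup>2 = (of_int x)\<^sup>2 * \<theta>\<^sup>2 + 2 * of_int x * of_int y * (\<theta> * \<omega>) + (of_int y)\<^sup>2 * \<omega>\<^sup>2"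
      by (simp add: \<beta>_def algebra_simps power2_eq_square)
    then show ?thesis by (simp add: assms)
  qed
  \<comment> \<open>From (a + b)^3 = a^3 + 3 a b (a + b) + b^3 with a = x \<theta> and b = y
    \<omega>: here a^3, b^3 and a b are integers, so no quadratic term appears.\<close>
  have "\<beta> ^ 3 = of_int (3 * x * y * h * k) * \<beta> + of_int (x ^ 3 * h * k\<^sup>2 + y ^ 3 * h\<^sup>2 * k)"
  proof -
    have \<theta>3: "\<theta> * \<theta>\<^sup>2 = of_int (h * k\<^sup>2)"
      unfolding assms(1) mult.left_commute[of \<theta>] assms(2) by (simp add: power2_eq_square)
    have \<omega>3: "\<omega> * \<omega>\<^sup>2 = of_int (h\<^sup>2 * k)"
      unfolding assms(3) mult.left_commute[of \<omega>] mult.commute[of \<omega> \<theta>] assms(2)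
      by (simp add: power2_eq_square)
    have "\<beta> ^ 3 = (of_int x) ^ 3 * (\<theta> * \<theta>\<^sup>2) + 3 * of_int x * of_int y * (\<theta> * \<omega>) * \<beta>
        + (of_int y) ^ 3 * (\<omega> * \<omega>\<^sup>2)"
      by (simp add: \<beta>_def algebra_simps power2_eq_square power3_eq_cube)
    then show ?thesis unfolding \<theta>3 \<omega>3 assms(2) by (simp add: algebra_simps)
  qed
  then have "int_adjoin \<beta> = int_mod.span {1, \<beta>, \<beta>\<^sup>2}" by (rule int_adjoin_cubic)
  also have "{1, \<beta>, \<beta>\<^sup>2} = set\<^sub>v (map_mat of_int (power_basis_mat h k x y) *\<^sub>v vec_of_list [1, \<theta>, \<omega>])"
  proof -
    define w where "w = map_mat of_int (power_basis_mat h k x y) *\<^sub>v vec_of_list [1, \<theta>, \<omega>]"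
    have dim: "dim_vec w = 3"
      using power_basis_mat_carrier[of h k x y] by (simp add: w_def)
    have entry: "w $ i = (\<Sum>j<3. of_int (power_basis_mat h k x y $$ (i, j)) * [1, \<theta>, \<omega>] ! j)"
      if "i < 3" for i
      using that power_basis_mat_carrier[of h k x y] vec_of_list_3_carrier[of 1 \<theta> \<omega>]
      by (simp add: w_def scalar_prod_def numeral_3_eq_3)
    have three: "{..<3} = {0, 1, 2::nat}" by auto
    have "w $ 0 = 1" "w $ 1 = \<beta>"
      by (simp_all add: entry three power_basis_mat_def mat_of_rows_list_def \<beta>_def)
    moreover have "w $ 2 = \<beta>\<^sup>2"
      unfolding sq by (simp add: entry three power_basis_mat_def mat_of_rows_list_def)
    ultimately have "set\<^sub>v w = {1, \<beta>, \<beta>\<^sup>2}"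
      by (simp only: vec_set_def dim three image_insert image_empty)
    then show ?thesis unfolding w_def by (rule sym)
  qed
  finally show ?thesis by (simp add: \<beta>_def lattice_of_def)
qed

text \<open>The constant coordinate stands last, in the form in which
  \<open>int_adjoin_translate\<close> removes it.\<close>

lemma lattice_of_coordinates:
  assumes "M \<in> carrier_mat r 3" "v \<in> lattice_of (vec_of_list [1, \<theta>, \<omega>]) M"
  obtains a x y :: int where "v = of_int x * \<theta> + of_int y * \<omega> + of_int a"
proof -
  from assms(2)[unfolded lattice_of_eq_range[OF assms(1) vec_of_list_3_carrier]] obtain e :: "nat \<Rightarrow> int" where
    "v = (\<Sum>j<3. of_int (e j) * vec_of_list [1, \<theta>, \<omega>] $ j)" by fast
  then have "v = of_int (e 1) * \<theta> + of_int (e 2) * \<omega> + of_int (e 0)"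
    by (simp add: numeral_3_eq_3 numeral_2_eq_2 algebra_simps)
  then show ?thesis by (rule that)
qed

section \<open>The Thue--Mahler equation\<close>

text \<open>The form is homogeneous of degree 3, so the cube of the gcd of \<open>x\<close> and
  \<open>y\<close> splits off and divides the prime power. Hence the gcd is \<open>p ^ j\<close>,
  and the exponent drops by \<open>3 * j\<close>.\<close>

lemma cubic_form_prime_power_primitive:
  fixes h k x y :: int and p n :: nat
  assumes p: "prime p" and F: "\<bar>k * x ^ 3 - h * y ^ 3\<bar> = int p ^ n"
  obtains U V N j where "(U, V, N) \<in> primitive_solutions k h p" "int n = N + 3 * int j"
    "x = int p ^ j * U" "y = int p ^ j * V"
proof -
  have p0: "p > 0" using p prime_gt_0_nat by blast
  define g where "g = gcd x y"
  have "g \<noteq> 0"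
  proof
    assume "g = 0"
    then have "x = 0" "y = 0" by (auto simp: g_def)
    then show False using F p0 by simp
  qed
  then obtain U V where UV: "x = U * g" "y = V * g" "coprime U V"
    using gcd_coprime_exists[of x y] unfolding g_def by auto
  have F': "k * x ^ 3 - h * y ^ 3 = g ^ 3 * (k * U ^ 3 - h * V ^ 3)"
    by (simp add: UV power_mult_distrib algebra_simps)
  have "g dvd g ^ 3" by simp
  also have "g ^ 3 dvd int p ^ n"
    using F unfolding F' by (metis abs_dvd_iff dvd_abs_iff dvd_triv_left)
  finally obtain j where j: "g = int p ^ j"
    using divides_primepow[of "int p" g n] p by (auto simp: g_def normalize_int_def)
  have "int p ^ (3 * j) dvd int p ^ n"
    using \<open>g ^ 3 dvd int p ^ n\<close> by (simp add: j power_mult[symmetric] mult.commute)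
  then have jn: "3 * j \<le> n"
    using prime_gt_1_nat[OF p] by (simp add: dvd_power_iff)
  have "int p ^ (3 * j) * \<bar>k * U ^ 3 - h * V ^ 3\<bar> = int p ^ (3 * j) * int p ^ (n - 3 * j)"
    using F unfolding F' using jn
    by (simp add: j abs_mult power_mult[symmetric] mult.commute power_add[symmetric])
  then have abs: "\<bar>k * U ^ 3 - h * V ^ 3\<bar> = int p ^ (n - 3 * j)" using p0 by simp
  \<comment> \<open>Solutions carry an integer exponent and a rational power; here the exponent is a
    natural number, so the power is an integer.\<close>
  have powi: "(of_nat p :: rat) powi (int (n - 3 * j)) = of_int (int p ^ (n - 3 * j))" by simp
  from abs have "k * U ^ 3 - h * V ^ 3 = int p ^ (n - 3 * j) \<or> k * U ^ 3 - h * V ^ 3 = - (int p ^ (n - 3 * j))"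
    by linarith
  then have "(U, V, int (n - 3 * j)) \<in> primitive_solutions k h p"
    unfolding primitive_solutions_def mem_Collect_eq case_prod_conv powi
    using UV(3) by (metis of_int_minus)
  then show ?thesis
    by (rule that[of _ _ _ j]) (use jn UV in \<open>auto simp: j mult.commute\<close>)
qed

theorem theorem4p4:
  fixes m h k :: int and p :: nat and \<theta> :: real and K :: "real set"
  assumes "cubefree m"
    and "\<not> [m ^ 2 = 1] (mod 9)"
    and "m = h * k ^ 2"
    and "squarefree h" and "squarefree k" and "coprime h k"
    and "prime p" and "p \<noteq> 2" and "p \<noteq> 3"
  defines "\<theta> \<equiv> root 3 (of_int m)"
  defines "K \<equiv> rat_adjoin \<theta>"
  shows "\<forall>\<^sub>F n in sequentially.
           ecard (mono_order_matrices K (vec_of_list [1, \<theta>, \<theta> ^ 2 / of_int k]) (int p ^ n))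
             \<le> 2 * ecard (primitive_solutions k h p)"
proof (cases "finite (primitive_solutions k h p)")
  \<comment> \<open>With infinitely many solutions the bound is infinite and nothing is to be
    shown.\<close>
  case False
  moreover have "2 * (\<infinity>::enat) = \<infinity>" by (simp add: mult_2)
  ultimately show ?thesis by (simp add: ecard_def)
next
  case fin: True
  define \<omega> where "\<omega> = \<theta>\<^sup>2 / of_int k"
  let ?b = "vec_of_list [1, \<theta>, \<omega>]"
  have cube: "\<theta> ^ 3 = of_int m" by (simp add: \<theta>_def odd_real_root_pow)
  have k: "k \<noteq> 0" using \<open>squarefree k\<close> by auto
  \<comment> \<open>The congruence excludes 1 and -1, the cube-free integers with a rational cube
    root.\<close>
  have m1: "m\<^sup>2 \<noteq> 1" using assms(2) by auto
  have b: "?b \<in> carrier_vec 3" by (rule vec_of_list_3_carrier)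
  have indep: "int_indep_vec ?b"
    unfolding \<omega>_def by (rule int_indep_vec_pure_cubic[OF assms(1) m1 cube k])
  \<comment> \<open>The multiplication table of the basis follows from \<theta>^3 = h k^2.\<close>
  have mult: "\<theta>\<^sup>2 = of_int k * \<omega>" "\<theta> * \<omega> = of_int (h * k)" "\<omega>\<^sup>2 = of_int h * \<theta>"
  proof -
    show "\<theta>\<^sup>2 = of_int k * \<omega>" using k by (simp add: \<omega>_def)
    have c: "\<theta> * \<theta>\<^sup>2 = of_int h * (of_int k)\<^sup>2"
      using cube by (simp add: assms(3) power3_eq_cube power2_eq_square)
    then show "\<theta> * \<omega> = of_int (h * k)" using k by (simp add: \<omega>_def field_simps power2_eq_square)
    have "\<theta>\<^sup>2 * \<theta>\<^sup>2 = of_int h * (of_int k)\<^sup>2 * \<theta>"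
      unfolding c[symmetric] by (simp add: power2_eq_square)
    then show "\<omega>\<^sup>2 = of_int h * \<theta>" using k by (simp add: \<omega>_def field_simps power2_eq_square)
  qed
  have "ecard (mono_order_matrices K ?b (int p ^ n)) \<le> 2 * ecard (primitive_solutions k h p)" for n
  proof -
    let ?S = "mono_order_matrices K ?b (int p ^ n)"
    have hnf: "M \<in> hnf_matrices 3 (int p ^ n)" if "M \<in> ?S" for M
      using that by (simp add: mono_order_matrices_def order_matrices_def numeral_3_eq_3)
    \<comment> \<open>A relation, since an order has several generators: \<beta> and -\<beta>, for
      instance, give different solutions.\<close>
    define R where "R M = (\<lambda>(U, V, N). \<exists>j. int n = N + 3 * int j \<and>
        lattice_of ?b M = int_adjoin (of_int (int p ^ j * U) * \<theta> + of_int (int p ^ j * V) * \<omega>))"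
      for M
    have "\<exists>s\<in>primitive_solutions k h p. R M s" if M: "M \<in> ?S" for M
    proof -
      have car: "M \<in> carrier_mat 3 3" and det: "det M = int p ^ n"
        using hnf[OF M] by (auto simp: hnf_matrices_def)
      obtain \<alpha> where \<alpha>: "\<alpha> \<in> lattice_of ?b M" "lattice_of ?b M = int_adjoin \<alpha>"
        using M by (auto simp: mono_order_matrices_def monogenic_def)
      obtain a x y where "\<alpha> = of_int x * \<theta> + of_int y * \<omega> + of_int a"
        using lattice_of_coordinates[OF car \<alpha>(1)] by metis
      then have lat: "lattice_of ?b M = int_adjoin (of_int x * \<theta> + of_int y * \<omega>)"
        using \<alpha>(2) int_adjoin_translate by simp
      also have "\<dots> = lattice_of ?b (power_basis_mat h k x y)"
        by (rule int_adjoin_eq_lattice_of[OF mult])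
      \<comment> \<open>Only absolute values agree: replacing \<beta> by -\<beta> changes the sign
        of the form. This is the source of the two signs in the equation.\<close>
      finally have "\<bar>det M\<bar> = \<bar>det (power_basis_mat h k x y)\<bar>"
        by (rule lattice_of_eq_imp_abs_det_eq[OF car power_basis_mat_carrier b indep])
      then have "\<bar>k * x ^ 3 - h * y ^ 3\<bar> = int p ^ n"
        by (simp add: det det_power_basis_mat)
      then obtain U V N j where "(U, V, N) \<in> primitive_solutions k h p" "int n = N + 3 * int j"
        "x = int p ^ j * U" "y = int p ^ j * V"
        by (rule cubic_form_prime_power_primitive[OF \<open>prime p\<close>])
      then show ?thesis using lat by (intro bexI[of _ "(U, V, N)"]) (auto simp: R_def)
    qed
    then obtain f where f: "\<And>M. M \<in> ?S \<Longrightarrow> f M \<in> primitive_solutions k h p"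
      "\<And>M. M \<in> ?S \<Longrightarrow> R M (f M)"
      by metis
    have "inj_on f ?S"
    proof (rule inj_onI)
      fix A B assume AB: "A \<in> ?S" "B \<in> ?S" "f A = f B"
      \<comment> \<open>For fixed \<open>n\<close> the exponent \<open>N\<close> determines
        \<open>j\<close>, so equal solutions give the same generator and the same order.\<close>
      then have "lattice_of ?b A = lattice_of ?b B"
        using f(2)[OF AB(1)] f(2)[OF AB(2)] by (auto simp: R_def split: prod.splits)
      then show "A = B"
        using hnf_unique[OF hnf[OF AB(1)] hnf[OF AB(2)] _ _ b indep] prime_gt_0_nat[OF \<open>prime p\<close>] by simp
    qed
    moreover have "f ` ?S \<subseteq> primitive_solutions k h p" using f(1) by blast
    ultimately have "finite ?S" "card ?S \<le> card (primitive_solutions k h p)"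
      using fin by (auto intro: inj_on_finite card_inj_on_le)
    then have "ecard ?S \<le> ecard (primitive_solutions k h p)" using fin by (simp add: ecard_def)
    also have "\<dots> \<le> 2 * ecard (primitive_solutions k h p)" by (simp add: mult_2)
    finally show ?thesis .
  qed
  then show ?thesis by (simp add: \<omega>_def)
qed

end
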